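(* For an integer $d\ge2$ and real $m>1$, consider the maximum of $\Delta_f$ over all monic polynomials $f$ of degree $d$ with $d$ real roots $x_1,\dots,x_d$ (counted with multiplicity) satisfying $|f(i)|=m$. (1) For $d=2$ and $1<m\le2$, the maximal value of $\Delta_f$ is $4(m-1)$, attained if and only if $\{x_1,x_2\}=\{-\sqrt{m-1},\sqrt{m-1}\}$. (2) For $d=3$ and $1<m\le4$, the maximal value of $\Delta_f$ is $4(m-1)^3$, attained if and only if $\{x_1,x_2,x_3\}=\{-\sqrt{m-1},0,\sqrt{m-1}\}$. (3) For $d=4$ and $1<m\le8$, the maximal value of $\Delta_f$ is $$\frac{1024}{3125}\Big(2(m^2+7m+1)^{3/2}(m^2-18m+1)+(m+1)\big(2m^4-17m^3+462m^2-17m+2\big)\Big),$$ attained if and only if $x_1,\dots,x_4$ are the roots of $$G(x)=x^4-\frac25\big(m-4+\sqrt{m^2+7m+1}\big)x^2+\frac{3m+3-2\sqrt{m^2+7m+1}}{5}.$$ (4) For $d=5$ and $1<m\le16$, the maximal value of $\Delta_f$ is $$\frac{55296}{823543}(m^2+23m+1)^{3/2}(m^2-54m-27)\Big(m^2+2m-\frac1{27}\Big)$$ $$+\frac{55296}{823543}(m+1)\Big(m^6-\frac{37}{2}m^5+\frac{56755}{27}m^4+\frac{287435}{27}m^3+\frac{56755}{27}m^2-\frac{37}{2}m+1\Big),$$ attained if and only if $x_1,\dots,x_5$ are the roots of $$G(x)=x^5-\frac27\big(m-6+\sqrt{m^2+23m+1}\big)x^3+\frac{5m+5-2\sqrt{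m^2+23m+1}}{7}\,x.$$
   Context: For a monic polynomial $f(x)=\prod_{k=1}^d(x-x_k)$ with real roots, $\Delta_f=\prod_{1\le j<k\le d}(x_j-x_k)^2$ is its discriminant. Here $i=\sqrt{-1}$. *)

theory Defs
  imports Complex_Main "HOL-Library.Multiset" "HOL-Computational_Algebra.Polynomial"
begin

text \<open>
  The roots of a real-rooted polynomial are taken from \<^const>\<open>proots\<close>, the multiset of its roots.
  The sorted enumeration only serves to number them; the value does not depend on
  the enumeration, see \<open>discriminant_prod_linear_factors\<close> below.
\<close>

definition discriminant :: "real poly \<Rightarrow> real" where
  "discriminant f = (let xs = sorted_list_of_multiset (proots f) in
     \<Prod>k<length xs. \<Prod>j<k. (xs ! j - xs ! k)\<^sup>2)"

text \<open>
  For \<^prop>\<open>f \<noteq> 0\<close>, \<^const>\<open>proots\<close> counts the real roots with multiplicity, so the condition on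
  its size says that all roots of \<open>f\<close> are real.
\<close>

definition real_rooted_monic :: "nat \<Rightarrow> real \<Rightarrow> real poly set" where
  "real_rooted_monic d m = {f. lead_coeff f = 1 \<and> degree f = d \<and> size (proots f) = d \<and>
     cmod (poly (map_poly complex_of_real f) \<i>) = m}"

definition is_max_value :: "('a \<Rightarrow> real) \<Rightarrow> 'a set \<Rightarrow> real \<Rightarrow> bool" where
  "is_max_value g A M \<longleftrightarrow> (\<exists>a\<in>A. g a = M) \<and> (\<forall>a\<in>A. g a \<le> M)"

lemma prod_pairs_Cons:
  fixes xs :: "real list"
  shows "(\<Prod>k<length (x # xs). \<Prod>j<k. ((x # xs) ! j - (x # xs) ! k)\<^sup>2) =
         (\<Prod>y\<in>#mset xs. (x - y)\<^sup>2) * (\<Prod>k<length xs. \<Prod>j<k. (xs ! j - xs ! k)\<^sup>2)"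
proof -
  have "(\<Prod>k<length (x # xs). \<Prod>j<k. ((x # xs) ! j - (x # xs) ! k)\<^sup>2) =
        (\<Prod>k<length xs. (x - xs ! k)\<^sup>2 * (\<Prod>j<k. (xs ! j - xs ! k)\<^sup>2))"
    by (simp only: list.size add_0_right add_Suc_right prod.lessThan_Suc_shift) simp
  also have "\<dots> = (\<Prod>k<length xs. (x - xs ! k)\<^sup>2) * (\<Prod>k<length xs. \<Prod>j<k. (xs ! j - xs ! k)\<^sup>2)"
    by (rule prod.distrib)
  also have "(\<Prod>k<length xs. (x - xs ! k)\<^sup>2) = prod_list (map (\<lambda>y. (x - y)\<^sup>2) xs)"
    by (simp add: prod.list_conv_set_nth atLeast0LessThan)
  also have "\<dots> = (\<Prod>y\<in>#mset xs. (x - y)\<^sup>2)"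
    by (metis mset_map prod_mset_prod_list)
  finally show ?thesis .
qed

lemma prod_pairs_move:
  fixes xs ys :: "real list"
  defines "D \<equiv> (\<lambda>xs :: real list. \<Prod>k<length xs. \<Prod>j<k. (xs ! j - xs ! k)\<^sup>2)"
  shows "D (xs @ x # ys) = D (x # xs @ ys)"
proof (induction xs)
  case (Cons a xs)
  have C: "D (z # zs) = (\<Prod>y\<in>#mset zs. (z - y)\<^sup>2) * D zs" for z zs
    unfolding D_def by (rule prod_pairs_Cons)
  show ?case
    using Cons by (simp add: C power2_commute[of a x])
qed simp

lemma prod_pairs_cong_mset:
  fixes xs ys :: "real list"
  assumes "mset xs = mset ys"
  shows "(\<Prod>k<length xs. \<Prod>j<k. (xs ! j - xs ! k)\<^sup>2) = (\<Prod>k<length ys. \<Prod>j<k. (ys ! j - ys ! k)\<^sup>2)"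
  using assms
proof (induction xs arbitrary: ys)
  case (Cons x xs)
  then obtain us vs where ys: "ys = us @ x # vs"
    by (metis list.set_intros(1) mset_eq_setD split_list)
  with Cons.prems have m: "mset xs = mset (us @ vs)" by simp
  show ?case
    unfolding ys prod_pairs_move prod_pairs_Cons Cons.IH[OF m] m ..
qed simp

lemma proots_prod_linear_factors:
  "proots (\<Prod>x\<leftarrow>xs. [:- x, 1:]) = mset (xs :: real list)"
proof (induction xs)
  case (Cons a xs)
  have "(\<Prod>x\<leftarrow>xs. [:- x, 1:]) \<noteq> (0 :: real poly)"
    by (auto simp: prod_list_zero_iff)
  with Cons show ?case
    by (simp add: proots_mult del: mult_pCons_left)
qed simp

lemma discriminant_prod_linear_factors:
  "discriminant (\<Prod>x\<leftarrow>xs. [:- x, 1:]) = (\<Prod>k<length xs. \<Prod>j<k. (xs ! j - xs ! k)\<^sup>2)"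
  unfolding discriminant_def proots_prod_linear_factors Let_def
  by (rule prod_pairs_cong_mset) simp

end

theory Submission
  imports Defs
begin

text \<open>
  Put \<open>x\<^sub>k = tan \<theta>\<^sub>k\<close>. Then \<open>m\<^sup>2 = \<Prod>k. 1 + x\<^sub>k\<^sup>2\<close> is the inverse of \<open>\<Prod>k. cos\<^sup>2 \<theta>\<^sub>k\<close>, and up to a power of
  \<open>m\<close> the discriminant is the product of the \<open>sin\<^sup>2 (\<theta>\<^sub>k - \<theta>\<^sub>j)\<close>. On ordered angles the Lagrangian
  \<open>\<Sum>j<k. ln (sin\<^sup>2 (\<theta>\<^sub>k - \<theta>\<^sub>j)) + \<mu> * (\<Sum>k. ln (cos\<^sup>2 \<theta>\<^sub>k))\<close> is concave when \<open>\<mu> \<ge> 0\<close>, so a critical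
  point with nonnegative multiplier is a global maximum; the bounds \<open>m \<le> 2 ^ (d - 1)\<close> are exactly
  the condition \<open>\<mu> \<ge> 0\<close> for the symmetric candidates. For \<open>\<mu> = 0\<close> the Lagrangian is invariant under
  a common rotation of the angles; uniqueness then comes from the strict concavity of
  \<open>\<Sum>k. ln (cos\<^sup>2 \<theta>\<^sub>k)\<close>, which is stationary along rotations because \<open>\<Sum>k. x\<^sub>k = 0\<close>.
\<close>

section \<open>Tangent-line bounds in the angle variable\<close>

text \<open>The derivative of \<open>ln (sin t)\<close> is \<open>cot t\<close>, which decreases
  strictly on the open interval from \<open>0\<close> to \<open>pi\<close>. By the mean value
  theorem the function therefore lies strictly below each tangent away from the point of
  contact.\<close>

lemma ln_sin_le_tangent:
  fixes u v :: real
  assumes "0 < u" "u < pi" "0 < v" "v < pi"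
  shows "ln (sin u) \<le> ln (sin v) + cot v * (u - v)"
    and "ln (sin u) = ln (sin v) + cot v * (u - v) \<Longrightarrow> u = v"
proof -
  have cot_less: "cot t < cot s" if "0 < s" "s < t" "t < pi" for s t :: real
  proof -
    have "0 < sin (t - s)" "0 < sin s" "0 < sin t"
      using that by (auto intro!: sin_gt_zero)
    then have "0 < sin (t - s) / (sin s * sin t)" by simp
    also have "\<dots> = cot s - cot t"
      using \<open>0 < sin s\<close> \<open>0 < sin t\<close> by (simp add: cot_def sin_diff field_simps)
    finally show ?thesis by simp
  qed
  have deriv: "((\<lambda>t. ln (sin t)) has_real_derivative cot t) (at t)" if "0 < t" "t < pi" for t
    using sin_gt_zero[OF that] by (auto intro!: derivative_eq_intros simp: cot_def)
  have less: "ln (sin u) < ln (sin v) + cot v * (u - v)" if "u \<noteq> v"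
  proof (cases "u < v")
    case True
    obtain z where z: "u < z" "z < v" "ln (sin v) - ln (sin u) = (v - u) * cot z"
      using MVT2[OF True, of "\<lambda>t. ln (sin t)" cot] deriv assms by force
    have "(v - u) * cot v < (v - u) * cot z"
      using cot_less[of z v] z assms by simp
    then show ?thesis using z by (simp add: algebra_simps)
  next
    case False
    with that have "v < u" by simp
    obtain z where z: "v < z" "z < u" "ln (sin u) - ln (sin v) = (u - v) * cot z"
      using MVT2[OF \<open>v < u\<close>, of "\<lambda>t. ln (sin t)" cot] deriv assms by force
    have "(u - v) * cot z < (u - v) * cot v"
      using cot_less[of v z] z assms by simp
    then show ?thesis using z by (simp add: algebra_simps)
  qed
  show "ln (sin u) \<le> ln (sin v) + cot v * (u - v)"
    using less by (cases "u = v") auto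
  show "u = v" if "ln (sin u) = ln (sin v) + cot v * (u - v)"
    using less that by (cases "u = v") auto
qed

text \<open>For \<open>\<theta> = arctan x\<close> the value \<open>ln (1 + x\<^sup>2)\<close> is
  \<open>- 2 * ln (sin (\<theta> + pi / 2))\<close>. The bound for \<open>ln (sin u)\<close> thus
  turns into strict convexity in \<open>\<theta>\<close>, with derivative
  \<open>2 * x\<close>.\<close>

lemma ln_one_plus_square_ge_tangent:
  fixes x a :: real
  shows "ln (1 + x\<^sup>2) \<ge> ln (1 + a\<^sup>2) + 2 * a * (arctan x - arctan a)"
    and "ln (1 + x\<^sup>2) = ln (1 + a\<^sup>2) + 2 * a * (arctan x - arctan a) \<Longrightarrow> x = a"
proof -
  have shift: "0 < arctan t + pi / 2" "arctan t + pi / 2 < pi" for t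
    using arctan_bounded[of t] by auto
  have pos: "0 < 1 + t\<^sup>2" for t :: real
    by (simp add: add_pos_nonneg)
  have ln: "ln (sin (arctan t + pi / 2)) = - ln (1 + t\<^sup>2) / 2" for t
    using pos[of t] by (simp add: sin_add cos_arctan ln_div ln_sqrt)
  have cot: "cot (arctan t + pi / 2) = - t" for t
    using tan_arctan[of t] by (simp add: cot_def sin_add cos_add tan_def)
  note tangent = ln_sin_le_tangent[OF shift[of x] shift[of a], unfolded ln cot]
  show "ln (1 + x\<^sup>2) \<ge> ln (1 + a\<^sup>2) + 2 * a * (arctan x - arctan a)"
    using tangent(1) by (simp add: algebra_simps)
  show "x = a" if "ln (1 + x\<^sup>2) = ln (1 + a\<^sup>2) + 2 * a * (arctan x - arctan a)"
  proof -
    have "- ln (1 + x\<^sup>2) / 2 = - ln (1 + a\<^sup>2) / 2 + - a * (arctan x + pi / 2 - (arctan a + pi / 2))"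
      unfolding that by (simp add: field_simps)
    from tangent(2)[OF this] show ?thesis by (simp add: arctan_eq_iff)
  qed
qed

text \<open>\<open>S x y\<close> is \<open>2 * ln (sin (arctan x - arctan y))\<close>, and the
  fraction is the cotangent of \<open>arctan a - arctan b\<close>. Only the angle difference enters,
  so equality fixes the two angles up to a common rotation.\<close>

lemma ln_chord_le_tangent:
  fixes a b x y :: real
  assumes "b < a" "y < x"
  defines "S \<equiv> (\<lambda>x y. ln ((y - x)\<^sup>2) - ln (1 + x\<^sup>2) - ln (1 + y\<^sup>2))"
  shows "S x y \<le> S a b + 2 * ((1 + a * b) / (a - b)) * ((arctan x - arctan a) - (arctan y - arctan b))"
    and "S x y = S a b + 2 * ((1 + a * b) / (a - b)) * ((arctan x - arctan a) - (arctan y - arctan b))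
      \<Longrightarrow> arctan x - arctan a = arctan y - arctan b"
proof -
  have range: "0 < arctan s - arctan t" "arctan s - arctan t < pi" if "t < s" for s t
    using arctan_bounded[of s] arctan_bounded[of t] that by (auto simp: arctan_less_iff)
  have pos: "0 < 1 + t\<^sup>2" for t :: real
    by (simp add: add_pos_nonneg)
  have sin: "sin (arctan s - arctan t) = (s - t) / (sqrt (1 + s\<^sup>2) * sqrt (1 + t\<^sup>2))" for s t
    by (simp add: sin_diff sin_arctan cos_arctan diff_divide_distrib)
  have ln: "2 * ln (sin (arctan s - arctan t)) = S s t" if "t < s" for s t
  proof -
    have "ln ((t - s)\<^sup>2) = 2 * ln (s - t)"
      using that by (subst power2_commute) (simp add: ln_realpow)
    moreover have "ln (sqrt (1 + z\<^sup>2)) = ln (1 + z\<^sup>2) / 2" for z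
      using pos[of z] by (intro ln_sqrt) simp
    moreover have "ln (sin (arctan s - arctan t))
        = ln (s - t) - (ln (sqrt (1 + s\<^sup>2)) + ln (sqrt (1 + t\<^sup>2)))"
      unfolding sin using that pos[of s] pos[of t]
      by (subst ln_divide_pos) (simp_all only: ln_mult_pos real_sqrt_gt_0_iff mult_pos_pos diff_gt_0_iff_gt)
    ultimately show ?thesis
      by (simp only: S_def) simp
  qed
  have cot: "cot (arctan s - arctan t) = (1 + s * t) / (s - t)" if "t < s" for s t
  proof -
    have "cos (arctan s - arctan t) = (1 + s * t) / (sqrt (1 + s\<^sup>2) * sqrt (1 + t\<^sup>2))"
      by (simp add: cos_diff sin_arctan cos_arctan add_divide_distrib)
    then show ?thesis
      using pos[of s] pos[of t] by (simp add: cot_def sin)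
  qed
  note tangent = ln_sin_le_tangent[OF range[OF assms(2)] range[OF assms(1)], unfolded cot[OF assms(1)]]
  show "S x y \<le> S a b + 2 * ((1 + a * b) / (a - b)) * ((arctan x - arctan a) - (arctan y - arctan b))"
    using tangent(1) ln[OF assms(1)] ln[OF assms(2)] by argo
  show "arctan x - arctan a = arctan y - arctan b"
    if "S x y = S a b + 2 * ((1 + a * b) / (a - b)) * ((arctan x - arctan a) - (arctan y - arctan b))"
    using tangent(2) ln[OF assms(1)] ln[OF assms(2)] that by argo
qed

section \<open>Concavity of the Lagrangian on ordered tuples\<close>

text \<open>Regroups contributions of pairs by index, the form in which the critical equations
  evaluate them.\<close>

lemma sum_pairs_symmetrize:
  fixes h :: "nat \<Rightarrow> nat \<Rightarrow> 'a :: comm_monoid_add"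
  shows "(\<Sum>k<d. \<Sum>j<k. h k j + h j k) = (\<Sum>k<d. \<Sum>j\<in>{..<d} - {k}. h k j)"
proof (induction d)
  case (Suc d)
  have "(\<Sum>j\<in>{..<Suc d} - {k}. h k j) = (\<Sum>j\<in>{..<d} - {k}. h k j) + h k d" if "k < d" for k
  proof -
    have "{..<Suc d} - {k} = insert d ({..<d} - {k})" using that by auto
    then show ?thesis by (simp add: add.commute)
  qed
  moreover have "{..<Suc d} - {d} = {..<d}" by auto
  ultimately show ?case
    using Suc by (simp add: sum.distrib ac_simps)
qed simp

text \<open>\<open>critical\<close> is stationarity of the Lagrangian at \<open>y\<close>: its
  derivative in the angle \<open>arctan (y k)\<close> is twice the left side minus twice the right
  side. Tangent bounds taken at \<open>y\<close> then control every admissible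
  \<open>x\<close>.\<close>

lemma prod_square_diff_le:
  fixes x y :: "nat \<Rightarrow> real"
  assumes x: "\<And>j k. j < k \<Longrightarrow> k < d \<Longrightarrow> x j < x k"
    and y: "\<And>j k. j < k \<Longrightarrow> k < d \<Longrightarrow> y j < y k"
    and critical: "\<And>k. k < d \<Longrightarrow> (\<Sum>j\<in>{..<d} - {k}. (1 + y k * y j) / (y k - y j)) = \<mu> * y k"
    and "0 \<le> \<mu>" and sum0: "(\<Sum>k<d. y k) = 0"
    and eq: "(\<Prod>k<d. 1 + (x k)\<^sup>2) = (\<Prod>k<d. 1 + (y k)\<^sup>2)"
  defines "D \<equiv> (\<lambda>x :: nat \<Rightarrow> real. \<Prod>k<d. \<Prod>j<k. (x j - x k)\<^sup>2)"
  shows "D x \<le> D y" and "D x = D y \<Longrightarrow> k < d \<Longrightarrow> x k = y k"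
proof -
  define L where "L = (\<lambda>x :: nat \<Rightarrow> real. \<Sum>k<d. ln (1 + (x k)\<^sup>2))"
  define S where "S = (\<lambda>x :: nat \<Rightarrow> real. \<lambda>k j.
    ln ((x j - x k)\<^sup>2) - ln (1 + (x k)\<^sup>2) - ln (1 + (x j)\<^sup>2))"
  \<comment> \<open>\<open>\<delta>\<close> is the angular displacement from \<open>y\<close> to
    \<open>x\<close>, and \<open>c k j\<close> is the cotangent of
    \<open>arctan (y k) - arctan (y j)\<close>.\<close>
  define \<delta> where "\<delta> k = arctan (x k) - arctan (y k)" for k
  define c where "c k j = (1 + y k * y j) / (y k - y j)" for k j
  have pos: "0 < 1 + t\<^sup>2" for t :: real
    by (simp add: add_pos_nonneg)
  have L: "L z = ln (\<Prod>k<d. 1 + (z k)\<^sup>2)" for z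
    unfolding L_def by (rule ln_prod[symmetric]) (auto simp: pos less_imp_neq[OF pos, symmetric])
  have Leq: "L x = L y"
    by (simp add: L eq)
  have Dpos: "0 < D z" if "\<And>j k. j < k \<Longrightarrow> k < d \<Longrightarrow> z j < z k" for z
    unfolding D_def using that by (intro prod_pos) force
  \<comment> \<open>Passing from squared differences to squared sines removes one factor
    \<open>1 + (z k)\<^sup>2\<close> for each of the \<open>d - 1\<close> pairs that contain
    \<open>k\<close>. The resulting multiple of \<open>L\<close> agrees for \<open>x\<close> and
    \<open>y\<close>.\<close>
  have lnD: "ln (D z) = (\<Sum>k<d. \<Sum>j<k. S z k j) + real (d - 1) * L z"
    if z: "\<And>j k. j < k \<Longrightarrow> k < d \<Longrightarrow> z j < z k" for z
  proof -
    have "ln (D z) = (\<Sum>k<d. ln (\<Prod>j<k. (z j - z k)\<^sup>2))"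
      unfolding D_def using z by (intro ln_prod) (force intro!: prod_pos)+
    also have "\<dots> = (\<Sum>k<d. \<Sum>j<k. ln ((z j - z k)\<^sup>2))"
      using z by (intro sum.cong refl ln_prod) force+
    also have "\<dots> = (\<Sum>k<d. \<Sum>j<k. S z k j) + (\<Sum>k<d. \<Sum>j<k. ln (1 + (z k)\<^sup>2) + ln (1 + (z j)\<^sup>2))"
      by (simp add: S_def sum.distrib[symmetric])
    also have "(\<Sum>k<d. \<Sum>j<k. ln (1 + (z k)\<^sup>2) + ln (1 + (z j)\<^sup>2)) = real (d - 1) * L z"
      by (subst sum_pairs_symmetrize) (simp add: L_def sum_distrib_left)
    finally show ?thesis .
  qed
  have lnDx: "ln (D x) = (\<Sum>k<d. \<Sum>j<k. S x k j) + real (d - 1) * L x" by (rule lnD) (rule x)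
  have lnDy: "ln (D y) = (\<Sum>k<d. \<Sum>j<k. S y k j) + real (d - 1) * L y" by (rule lnD) (rule y)
  have pair: "S x k j \<le> S y k j + 2 * c k j * (\<delta> k - \<delta> j)"
    "S x k j = S y k j + 2 * c k j * (\<delta> k - \<delta> j) \<Longrightarrow> \<delta> k = \<delta> j" if "j < k" "k < d" for j k
    unfolding S_def c_def \<delta>_def
    using ln_chord_le_tangent[OF y[OF that] x[OF that]] by simp_all
  \<comment> \<open>Since \<open>c\<close> is antisymmetric, each pair term splits into one share
    per index. The shares of index \<open>k\<close> add up to
    \<open>\<mu> * y k * \<delta> k\<close> by \<open>critical\<close>.\<close>
  have "(\<Sum>k<d. \<Sum>j<k. c k j * (\<delta> k - \<delta> j)) = (\<Sum>k<d. \<Sum>j<k. c k j * \<delta> k + c j k * \<delta> j)"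
  proof (intro sum.cong refl)
    fix k j
    have "c j k = - c k j"
      unfolding c_def by (metis minus_diff_eq minus_divide_right mult.commute)
    then show "c k j * (\<delta> k - \<delta> j) = c k j * \<delta> k + c j k * \<delta> j"
      by (simp add: algebra_simps)
  qed
  also have "\<dots> = (\<Sum>k<d. \<mu> * y k * \<delta> k)"
    unfolding sum_pairs_symmetrize[of "\<lambda>k j. c k j * \<delta> k"] sum_distrib_right[symmetric]
    using critical by (simp add: c_def)
  finally have grad: "(\<Sum>k<d. \<Sum>j<k. c k j * (\<delta> k - \<delta> j)) = \<mu> * (\<Sum>k<d. y k * \<delta> k)"
    by (simp add: sum_distrib_left mult.assoc)
  \<comment> \<open>Convexity of \<open>ln (1 + x\<^sup>2)\<close> in the angle, together with
    \<open>L x = L y\<close>, gives the first-order term its sign.\<close>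
  have "(\<Sum>k<d. ln (1 + (y k)\<^sup>2) + 2 * y k * \<delta> k) \<le> L x"
    unfolding L_def \<delta>_def by (intro sum_mono ln_one_plus_square_ge_tangent)
  then have "(\<Sum>k<d. y k * \<delta> k) \<le> 0"
    using Leq by (simp add: sum.distrib L_def mult.assoc sum_distrib_left[symmetric])
  with \<open>0 \<le> \<mu>\<close> have grad_le: "\<mu> * (\<Sum>k<d. y k * \<delta> k) \<le> 0"
    by (rule mult_nonneg_nonpos)
  have le: "(\<Sum>k<d. \<Sum>j<k. S x k j) \<le> (\<Sum>k<d. \<Sum>j<k. S y k j + 2 * c k j * (\<delta> k - \<delta> j))"
    using pair by (intro sum_mono) auto
  have rhs: "(\<Sum>k<d. \<Sum>j<k. S y k j + 2 * c k j * (\<delta> k - \<delta> j))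
      = (\<Sum>k<d. \<Sum>j<k. S y k j) + 2 * (\<mu> * (\<Sum>k<d. y k * \<delta> k))"
    by (simp add: sum.distrib mult.assoc sum_distrib_left[symmetric] grad)
  have "ln (D x) \<le> ln (D y)"
    using le rhs grad_le Leq lnDx lnDy by simp
  then show "D x \<le> D y"
    using Dpos[OF x] Dpos[OF y] by simp
  assume "D x = D y" "k < d"
  \<comment> \<open>Equal values squeeze the nonpositive first-order term to zero. The summed
    tangent bounds are then an equality, hence so is each single one.\<close>
  then have tight: "(\<Sum>k<d. \<Sum>j<k. S x k j) = (\<Sum>k<d. \<Sum>j<k. S y k j + 2 * c k j * (\<delta> k - \<delta> j))"
    using le rhs grad_le Leq lnDx lnDy by simp
  have const: "\<delta> k = \<delta> j" if jk: "j < k" "k < d" for j k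
  proof -
    have row: "(\<Sum>j<k. S x k j) = (\<Sum>j<k. S y k j + 2 * c k j * (\<delta> k - \<delta> j))"
      by (rule sum_mono_inv[OF tight]) (use pair jk in \<open>auto intro!: sum_mono\<close>)
    have "S x k j = S y k j + 2 * c k j * (\<delta> k - \<delta> j)"
      by (rule sum_mono_inv[OF row]) (use pair jk in auto)
    with jk show ?thesis by (rule pair(2))
  qed
  \<comment> \<open>All displacements agree, so \<open>sum0\<close> makes this sum vanish whatever
    \<open>\<mu>\<close> is. The convexity bounds then sum to an equality too, and their strictness
    excludes a nontrivial rotation.\<close>
  have "(\<Sum>k<d. y k * \<delta> k) = (\<Sum>k<d. y k * \<delta> 0)"
  proof (intro sum.cong refl)
    fix k assume "k \<in> {..<d}"
    then show "y k * \<delta> k = y k * \<delta> 0"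
      using const[of 0 k] by (cases "k = 0") auto
  qed
  also have "\<dots> = 0"
    by (simp add: sum_distrib_right[symmetric] sum0)
  finally have "(\<Sum>k<d. ln (1 + (y k)\<^sup>2) + 2 * y k * \<delta> k) = (\<Sum>k<d. ln (1 + (x k)\<^sup>2))"
    using Leq by (simp add: sum.distrib L_def mult.assoc sum_distrib_left[symmetric])
  then have "ln (1 + (y k)\<^sup>2) + 2 * y k * \<delta> k = ln (1 + (x k)\<^sup>2)"
    by (rule sum_mono_inv) (use \<open>k < d\<close> in \<open>auto simp: \<delta>_def ln_one_plus_square_ge_tangent\<close>)
  then show "x k = y k"
    unfolding \<delta>_def by (rule ln_one_plus_square_ge_tangent(2)[OF sym])
qed

section \<open>From ordered tuples to real-rooted polynomials\<close>

text \<open>Splitting off a root lowers the degree and the number of roots by one each, so the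
  hypothesis passes to the cofactor.\<close>

lemma prod_mset_linear_factors_proots:
  fixes f :: "'a :: idom poly"
  assumes "lead_coeff f = 1" "size (proots f) = degree f"
  shows "(\<Prod>x\<in>#proots f. [:- x, 1:]) = f"
  using assms
proof (induction "degree f" arbitrary: f)
  case 0
  then have "f = 1"
    by (metis degree_0_id one_pCons)
  then show ?case by simp
next
  case (Suc n)
  then obtain a where a: "a \<in># proots f"
    by (metis multiset_nonemptyE nat.distinct(1) size_empty)
  have "f \<noteq> 0" using Suc by auto
  with a have "poly f a = 0" by simp
  then obtain g where g: "f = [:- a, 1:] * g"
    using poly_eq_0_iff_dvd by blast
  with \<open>f \<noteq> 0\<close> have "g \<noteq> 0" by auto
  have proots: "proots f = add_mset a (proots g)"
    unfolding g using \<open>g \<noteq> 0\<close> by (subst proots_mult) auto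
  have "degree f = Suc (degree g)"
    unfolding g using \<open>g \<noteq> 0\<close> by (subst degree_mult_eq) auto
  moreover have "lead_coeff f = lead_coeff g"
    unfolding g lead_coeff_mult by simp
  ultimately have "(\<Prod>x\<in>#proots g. [:- x, 1:]) = g"
    using Suc proots by simp
  then show ?case
    unfolding proots by (simp add: g)
qed

text \<open>Each root \<open>a\<close> contributes the modulus of \<open>\<i> - a\<close>, which
  turns the condition at \<open>\<i>\<close> into the product constraint on the roots.\<close>

lemma cmod_poly_prod_linear_factors_ii:
  "cmod (poly (map_poly complex_of_real (\<Prod>x\<leftarrow>xs. [:- x, 1:])) \<i>) = sqrt (\<Prod>x\<leftarrow>xs. 1 + x\<^sup>2)"
proof (induction xs)
  case (Cons a xs)
  define g where "g = (\<Prod>x\<leftarrow>xs. [:- x, 1:])"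
  have "map_poly complex_of_real ([:- a, 1:] * g) = [:- of_real a, 1:] * map_poly of_real g"
    by (rule poly_eqI) (simp add: coeff_map_poly coeff_pCons split: nat.split)
  moreover have "cmod (\<i> - of_real a) = sqrt (1 + a\<^sup>2)"
    by (simp add: cmod_def)
  ultimately show ?case
    using Cons by (simp add: g_def norm_mult real_sqrt_mult del: mult_pCons_left)
qed simp

lemma prod_linear_factors_in_real_rooted_monic_iff:
  "(\<Prod>x\<leftarrow>xs. [:- x, 1:]) \<in> real_rooted_monic d m \<longleftrightarrow>
    length xs = d \<and> sqrt (\<Prod>x\<leftarrow>xs. 1 + x\<^sup>2) = m"
proof -
  have monic: "lead_coeff (\<Prod>x\<leftarrow>xs. [:- x, 1:]) = 1"
    by (induction xs) (simp_all add: lead_coeff_mult del: mult_pCons_left)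
  have "degree (\<Prod>x\<leftarrow>xs. [:- x, 1:]) = length xs"
  proof (induction xs)
    case (Cons a xs)
    have "(\<Prod>x\<leftarrow>xs. [:- x, 1:]) \<noteq> 0"
      by (auto simp: prod_list_zero_iff)
    with Cons show ?case
      by (simp add: degree_mult_eq del: mult_pCons_left)
  qed simp
  with monic show ?thesis
    unfolding real_rooted_monic_def
    by (auto simp: proots_prod_linear_factors cmod_poly_prod_linear_factors_ii)
qed

text \<open>In the assumption \<open>critical\<close> the summand for \<^prop>\<open>z = y\<close> is a division by zero, hence \<open>0\<close>.\<close>

lemma discriminant_maximal:
  fixes ys :: "real list"
  assumes sorted: "sorted_wrt (<) ys" and length: "length ys = d"
    and critical: "\<And>y. y \<in> set ys \<Longrightarrow> (\<Sum>z\<leftarrow>ys. (1 + y * z) / (y - z)) = \<mu> * y"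
    and "0 \<le> \<mu>" and sum0: "sum_list ys = 0"
    and m: "(\<Prod>y\<leftarrow>ys. 1 + y\<^sup>2) = m\<^sup>2" "0 \<le> m"
    and M: "(\<Prod>k<d. \<Prod>j<k. (ys ! j - ys ! k)\<^sup>2) = M"
  shows "is_max_value discriminant (real_rooted_monic d m) M \<and>
    (\<forall>f\<in>real_rooted_monic d m. discriminant f = M \<longleftrightarrow> proots f = mset ys)"
proof -
  have y: "ys ! j < ys ! k" if "j < k" "k < d" for j k
    using sorted that length by (simp add: sorted_wrt_iff_nth_less)
  have crit: "(\<Sum>j\<in>{..<d} - {k}. (1 + ys ! k * ys ! j) / (ys ! k - ys ! j)) = \<mu> * ys ! k"
    if "k < d" for k
  proof -
    have "\<mu> * ys ! k = (\<Sum>j<d. (1 + ys ! k * ys ! j) / (ys ! k - ys ! j))"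
      using critical[of "ys ! k"] that length by (simp add: sum_list_sum_nth atLeast0LessThan)
    also have "\<dots> = (\<Sum>j\<in>{..<d} - {k}. (1 + ys ! k * ys ! j) / (ys ! k - ys ! j))"
      using that by (subst sum.remove[of _ k]) auto
    finally show ?thesis ..
  qed
  have sum0': "(\<Sum>k<d. ys ! k) = 0"
    using sum0 length by (simp add: sum_list_sum_nth atLeast0LessThan)
  have Mpos: "0 < M"
    unfolding M[symmetric] using y by (intro prod_pos) force
  have bound: "discriminant f \<le> M \<and> (discriminant f = M \<longrightarrow> proots f = mset ys)"
    if f: "f \<in> real_rooted_monic d m" for f
  proof -
    define xs where "xs = sorted_list_of_multiset (proots f)"
    have proots: "proots f = mset xs"
      by (simp add: xs_def)
    have "f = (\<Prod>x\<in>#proots f. [:- x, 1:])"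
      using f by (intro prod_mset_linear_factors_proots[symmetric]) (auto simp: real_rooted_monic_def)
    also have "\<dots> = (\<Prod>x\<leftarrow>xs. [:- x, 1:])"
      unfolding proots by (metis mset_map prod_mset_prod_list)
    finally have fxs: "f = (\<Prod>x\<leftarrow>xs. [:- x, 1:])" .
    with f have xs: "length xs = d" "sqrt (\<Prod>x\<leftarrow>xs. 1 + x\<^sup>2) = m"
      using prod_linear_factors_in_real_rooted_monic_iff by auto
    have disc: "discriminant f = (\<Prod>k<d. \<Prod>j<k. (xs ! j - xs ! k)\<^sup>2)"
      unfolding fxs discriminant_prod_linear_factors xs(1) ..
    show ?thesis
    proof (cases "distinct xs")
      case True
      then have "sorted_wrt (<) xs"
        by (simp add: strict_sorted_iff xs_def)
      then have x: "xs ! j < xs ! k" if "j < k" "k < d" for j k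
        using that xs(1) by (simp add: sorted_wrt_iff_nth_less)
      have "0 \<le> (\<Prod>x\<leftarrow>xs. 1 + x\<^sup>2)"
        by (intro prod_list_nonneg) auto
      with xs(2) m(1) have "(\<Prod>x\<leftarrow>xs. 1 + x\<^sup>2) = (\<Prod>y\<leftarrow>ys. 1 + y\<^sup>2)"
        by auto
      then have eq: "(\<Prod>k<d. 1 + (xs ! k)\<^sup>2) = (\<Prod>k<d. 1 + (ys ! k)\<^sup>2)"
        using xs(1) length by (simp add: prod.list_conv_set_nth atLeast0LessThan)
      note max = prod_square_diff_le[where x = "(!) xs" and y = "(!) ys" and d = d,
        OF x y crit \<open>0 \<le> \<mu>\<close> sum0' eq, unfolded M disc[symmetric]]
      have "proots f = mset ys" if "discriminant f = M"
        unfolding proots using max(2)[OF _ _ _ _ _ that] xs(1) length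
        by (metis nth_equalityI)
      with max(1) show ?thesis by blast
    next
      \<comment> \<open>A repeated root makes the discriminant zero, whereas \<open>M\<close> is
        positive.\<close>
      case False
      then obtain j k where "j < k" "k < d" "xs ! j = xs ! k"
        using xs(1) by (metis distinct_conv_nth linorder_neqE_nat)
      then have "(\<Prod>j<k. (xs ! j - xs ! k)\<^sup>2) = 0"
        by (intro prod_zero) auto
      with \<open>k < d\<close> have "discriminant f = 0"
        unfolding disc by (intro prod_zero) auto
      with Mpos show ?thesis by simp
    qed
  qed
  have "0 \<le> (\<Prod>y\<leftarrow>ys. 1 + y\<^sup>2)"
    by (intro prod_list_nonneg) auto
  with m have "sqrt (\<Prod>y\<leftarrow>ys. 1 + y\<^sup>2) = m" by simp
  with length have mem: "(\<Prod>y\<leftarrow>ys. [:- y, 1:]) \<in> real_rooted_monic d m"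
    by (simp add: prod_linear_factors_in_real_rooted_monic_iff)
  \<comment> \<open>The discriminant depends on \<open>f\<close> only through
    \<open>proots f\<close>, which settles the converse of the equality case.\<close>
  have val: "discriminant f = M" if "proots f = mset ys" for f
  proof -
    have "discriminant f = discriminant (\<Prod>y\<leftarrow>ys. [:- y, 1:])"
      unfolding discriminant_def that proots_prod_linear_factors ..
    then show ?thesis
      unfolding discriminant_prod_linear_factors length M .
  qed
  show ?thesis
    unfolding is_max_value_def
    using bound mem val val[OF proots_prod_linear_factors] by blast
qed

section \<open>Critical equations for roots symmetric about zero\<close>

text \<open>The squares of \<open>p\<close> and \<open>q\<close> are the roots
  \<open>(a + r) / 2\<close> and \<open>(a - r) / 2\<close> of \<open>t\<^sup>2 - a * t + b\<close>;
  both are positive because \<open>0 < r < a\<close>.\<close>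

lemma biquadratic_roots:
  fixes a b :: real
  assumes "0 < a" "0 < b" "4 * b < a\<^sup>2"
  obtains p q where "0 < q" "q < p" "a = p\<^sup>2 + q\<^sup>2" "b = p\<^sup>2 * q\<^sup>2"
proof -
  define r where "r = sqrt (a\<^sup>2 - 4 * b)"
  have r: "r\<^sup>2 = a\<^sup>2 - 4 * b" "0 < r"
    using assms by (simp_all add: r_def)
  have "r\<^sup>2 < a\<^sup>2" using r assms by simp
  then have "r < a" using assms(1) by (simp add: power2_less_imp_less)
  show thesis
  proof (rule that[of "sqrt ((a - r) / 2)" "sqrt ((a + r) / 2)"])
    show "b = (sqrt ((a + r) / 2))\<^sup>2 * (sqrt ((a - r) / 2))\<^sup>2"
      using \<open>r < a\<close> r by (simp add: field_simps power2_eq_square)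
  qed (use \<open>r < a\<close> r assms in \<open>simp_all add: field_simps\<close>)
qed

text \<open>
  The left-hand side is the sum of the \<open>(1 + p * z) / (p - z)\<close> over the other roots \<open>z\<close>, for the roots
  \<open>- p, - q, q, p\<close> if \<^prop>\<open>\<kappa> = 1\<close>, and for these together with \<open>0\<close> if \<^prop>\<open>\<kappa> = 3\<close>.
\<close>

lemma critical_pairs:
  fixes p q :: real
  assumes "p \<noteq> 0" "q \<noteq> 0" "p\<^sup>2 \<noteq> q\<^sup>2"
    and "\<kappa> * (p\<^sup>2 - q\<^sup>2)\<^sup>2 = 4 * (p\<^sup>2 * q\<^sup>2) * (2 + (p\<^sup>2 + q\<^sup>2))"
  shows "(\<kappa> - p\<^sup>2) / (2 * p) + (1 + p * q) / (p - q) + (1 - p * q) / (p + q) =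
    (\<kappa> * (p\<^sup>2 + q\<^sup>2) / (4 * (p\<^sup>2 * q\<^sup>2)) - 3 / 2) * p"
proof -
  have "p - q \<noteq> 0" "p + q \<noteq> 0"
    using assms(3) by (auto simp: add_eq_0_iff)
  then have pair: "(1 + p * q) / (p - q) + (1 - p * q) / (p + q) = 2 * (1 + q\<^sup>2) / (p\<^sup>2 - q\<^sup>2) * p"
    using assms(3) by (simp add: divide_simps) (simp add: algebra_simps power2_eq_square)
  \<comment> \<open>After a factor \<open>p\<close> is taken out only the squares remain. The last
    hypothesis says exactly that the left side below keeps its value when \<open>u\<close> and
    \<open>v\<close> are swapped; the right side is the mean of the two values, hence one multiplier
    serves both \<open>p\<close> and \<open>q\<close>.\<close>
  define u v where "u = p\<^sup>2" and "v = q\<^sup>2"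
  have "(\<kappa> - u) / (2 * u) + 2 * (1 + v) / (u - v) = \<kappa> * (u + v) / (4 * (u * v)) - 3 / 2"
  proof -
    have nz: "u \<noteq> 0" "v \<noteq> 0" "u - v \<noteq> 0"
      using assms by (simp_all add: u_def v_def)
    have "\<kappa> * (u - v)\<^sup>2 = 4 * (u * v) * (2 + (u + v))"
      using assms(4) by (simp add: u_def v_def)
    then have "(\<kappa> - u) * (2 * v * (u - v)) + 2 * (1 + v) * (4 * u * v)
        = \<kappa> * (u + v) * (u - v) - 3 / 2 * (4 * u * v * (u - v))"
      by (simp add: algebra_simps power2_eq_square)
    then show ?thesis
      using nz by (simp add: divide_simps) (simp add: algebra_simps)
  qed
  then have "((\<kappa> - u) / (2 * u) + 2 * (1 + v) / (u - v)) * p = (\<kappa> * (u + v) / (4 * (u * v)) - 3 / 2) * p"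
    by (rule arg_cong)
  moreover have "(\<kappa> - p\<^sup>2) / (2 * p) = (\<kappa> - u) / (2 * u) * p"
    using assms(1) by (simp add: u_def power2_eq_square)
  ultimately show ?thesis
    unfolding add.assoc pair by (simp only: u_def v_def distrib_right)
qed

section \<open>Degrees two and three\<close>

lemma discriminant_maximal_quadratic:
  fixes m :: real
  assumes "1 < m" "m \<le> 2"
  shows "is_max_value discriminant (real_rooted_monic 2 m) (4 * (m - 1)) \<and>
    (\<forall>f\<in>real_rooted_monic 2 m. discriminant f = 4 * (m - 1) \<longleftrightarrow>
      proots f = {#- sqrt (m - 1), sqrt (m - 1)#})"
proof -
  define r where "r = sqrt (m - 1)"
  have r: "0 < r" "r\<^sup>2 = m - 1"
    using assms by (simp_all add: r_def)
  have "mset [- r, r] = {#- r, r#}" by simp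
  moreover have "is_max_value discriminant (real_rooted_monic 2 m) (4 * (m - 1)) \<and>
    (\<forall>f\<in>real_rooted_monic 2 m. discriminant f = 4 * (m - 1) \<longleftrightarrow> proots f = mset [- r, r])"
  \<comment> \<open>The multiplier solves the equation at \<open>r\<close>, where \<open>- r\<close>
    contributes \<open>(1 - r\<^sup>2) / (2 * r)\<close>. It is nonnegative iff
    \<open>r\<^sup>2 \<le> 1\<close>, that is \<open>m \<le> 2\<close>.\<close>
  proof (rule discriminant_maximal[where \<mu> = "(1 - r\<^sup>2) / (2 * r\<^sup>2)"])
    show "(\<Sum>z\<leftarrow>[- r, r]. (1 + y * z) / (y - z)) = (1 - r\<^sup>2) / (2 * r\<^sup>2) * y"
      if "y \<in> set [- r, r]" for y
      using that r(1) by (auto simp: power2_eq_square field_simps)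
    show "(\<Prod>k<2. \<Prod>j<k. ([- r, r] ! j - [- r, r] ! k)\<^sup>2) = 4 * (m - 1)"
      using r(2) by (simp add: eval_nat_numeral lessThan_Suc algebra_simps)
    show "(\<Prod>y\<leftarrow>[- r, r]. 1 + y\<^sup>2) = m\<^sup>2"
      using r(2) by (simp add: power2_eq_square)
  qed (use assms r in auto)
  ultimately show ?thesis unfolding r_def by simp
qed

lemma discriminant_maximal_cubic:
  fixes m :: real
  assumes "1 < m" "m \<le> 4"
  shows "is_max_value discriminant (real_rooted_monic 3 m) (4 * (m - 1) ^ 3) \<and>
    (\<forall>f\<in>real_rooted_monic 3 m. discriminant f = 4 * (m - 1) ^ 3 \<longleftrightarrow>
      proots f = {#- sqrt (m - 1), 0, sqrt (m - 1)#})"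
proof -
  define r where "r = sqrt (m - 1)"
  have r: "0 < r" "r\<^sup>2 = m - 1"
    using assms by (simp_all add: r_def)
  have "mset [- r, 0, r] = {#- r, 0, r#}" by simp
  moreover have "is_max_value discriminant (real_rooted_monic 3 m) (4 * (m - 1) ^ 3) \<and>
    (\<forall>f\<in>real_rooted_monic 3 m. discriminant f = 4 * (m - 1) ^ 3 \<longleftrightarrow> proots f = mset [- r, 0, r])"
  \<comment> \<open>The root \<open>0\<close> adds \<open>1 / r\<close> to the equation at
    \<open>r\<close>, which replaces \<open>1\<close> by \<open>3\<close> in the numerator;
    nonnegativity now means \<open>m \<le> 4\<close>.\<close>
  proof (rule discriminant_maximal[where \<mu> = "(3 - r\<^sup>2) / (2 * r\<^sup>2)"])
    show "(\<Sum>z\<leftarrow>[- r, 0, r]. (1 + y * z) / (y - z)) = (3 - r\<^sup>2) / (2 * r\<^sup>2) * y"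
      if "y \<in> set [- r, 0, r]" for y
      using that r(1) by (auto simp: power2_eq_square field_simps)
    have "(\<Prod>k<3. \<Prod>j<k. ([- r, 0, r] ! j - [- r, 0, r] ! k)\<^sup>2) = 4 * (r\<^sup>2) ^ 3"
      by (simp add: eval_nat_numeral lessThan_Suc algebra_simps)
    then show "(\<Prod>k<3. \<Prod>j<k. ([- r, 0, r] ! j - [- r, 0, r] ! k)\<^sup>2) = 4 * (m - 1) ^ 3"
      using r(2) by simp
    show "(\<Prod>y\<leftarrow>[- r, 0, r]. 1 + y\<^sup>2) = m\<^sup>2"
      using r(2) by (simp add: power2_eq_square)
  qed (use assms r in auto)
  ultimately show ?thesis unfolding r_def by simp
qed

section \<open>Degrees four and five in terms of coefficients\<close>

text \<open>On a list symmetric about zero this carries the critical equation from \<open>y\<close>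
  to \<open>- y\<close>.\<close>

lemma one_plus_mult_over_diff_uminus:
  fixes y z :: "'a :: field"
  shows "(1 + - y * z) / (- y - z) = - ((1 + y * - z) / (y - - z))"
proof -
  have "- y - z = - (y - - z)" by simp
  then show ?thesis by (simp only: divide_minus_right mult_minus_left mult_minus_right)
qed

text \<open>For the roots \<open>- p, - q, q, p\<close> one has
  \<open>a\<^sup>2 - 4 * b = (p\<^sup>2 - q\<^sup>2)\<^sup>2\<close>, so \<open>stationary\<close>
  is the hypothesis of \<open>critical_pairs\<close> with \<open>\<kappa> = 1\<close>. The bound
  \<open>6 * b \<le> a\<close> says \<open>0 \<le> \<mu>\<close>, and \<open>1 + a + b\<close>
  factors as \<open>(1 + p\<^sup>2) * (1 + q\<^sup>2)\<close>.\<close>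

lemma discriminant_maximal_biquadratic:
  fixes a b m :: real
  assumes "0 < a" "0 < b" and stationary: "a\<^sup>2 - 4 * b = 4 * b * (2 + a)"
    and "6 * b \<le> a" and m: "1 + a + b = m"
    and M: "16 * b * (a\<^sup>2 - 4 * b)\<^sup>2 = M"
  shows "is_max_value discriminant (real_rooted_monic 4 m) M \<and>
    (\<forall>f\<in>real_rooted_monic 4 m. discriminant f = M \<longleftrightarrow> proots f = proots [:b, 0, - a, 0, 1:])"
proof -
  have "0 < 4 * b * (2 + a)"
    using assms(1,2) by simp
  then have "4 * b < a\<^sup>2"
    using stationary by simp
  then obtain p q where pq: "0 < q" "q < p" and ab: "a = p\<^sup>2 + q\<^sup>2" "b = p\<^sup>2 * q\<^sup>2"
    using biquadratic_roots assms(1,2) by metis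
  define ys where "ys = [- p, - q, q, p]"
  have poly: "[:b, 0, - a, 0, 1:] = (\<Prod>y\<leftarrow>ys. [:- y, 1:])"
    by (simp add: ys_def ab algebra_simps power2_eq_square)
  have sq: "p\<^sup>2 \<noteq> q\<^sup>2"
    using pq by (simp add: power2_eq_iff)
  define \<mu> where "\<mu> = a / (4 * b) - 3 / 2"
  have critical_p: "(1 - p\<^sup>2) / (2 * p) + (1 + p * q) / (p - q) + (1 - p * q) / (p + q) = \<mu> * p"
    using critical_pairs[of p q 1] pq sq stationary
    by (simp add: \<mu>_def ab algebra_simps power2_eq_square)
  have critical_q: "(1 - q\<^sup>2) / (2 * q) + (1 + q * p) / (q - p) + (1 - q * p) / (q + p) = \<mu> * q"
    using critical_pairs[of q p 1] pq sq stationary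
    by (simp add: \<mu>_def ab algebra_simps power2_eq_square)
  have "is_max_value discriminant (real_rooted_monic 4 m) M \<and>
    (\<forall>f\<in>real_rooted_monic 4 m. discriminant f = M \<longleftrightarrow> proots f = mset ys)"
  proof (rule discriminant_maximal[where \<mu> = \<mu>])
    have odd: "(\<Sum>z\<leftarrow>ys. (1 + - y * z) / (- y - z)) = - (\<Sum>z\<leftarrow>ys. (1 + y * z) / (y - z))" for y
      unfolding one_plus_mult_over_diff_uminus by (simp add: ys_def)
    have "(\<Sum>z\<leftarrow>ys. (1 + p * z) / (p - z)) = \<mu> * p"
      using critical_p by (simp add: ys_def power2_eq_square algebra_simps)
    moreover have "(\<Sum>z\<leftarrow>ys. (1 + q * z) / (q - z)) = \<mu> * q"
      using critical_q by (simp add: ys_def power2_eq_square algebra_simps)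
    ultimately show "(\<Sum>z\<leftarrow>ys. (1 + y * z) / (y - z)) = \<mu> * y" if "y \<in> set ys" for y
      using that odd[of p] odd[of q] unfolding ys_def by auto
    have "(\<Prod>k<4. \<Prod>j<k. (ys ! j - ys ! k)\<^sup>2) = 16 * (p\<^sup>2 * q\<^sup>2) * ((p - q)\<^sup>2 * (p + q)\<^sup>2)\<^sup>2"
      by (simp add: ys_def eval_nat_numeral lessThan_Suc) algebra
    also have "(p - q)\<^sup>2 * (p + q)\<^sup>2 = a\<^sup>2 - 4 * b"
      unfolding ab by algebra
    finally show "(\<Prod>k<4. \<Prod>j<k. (ys ! j - ys ! k)\<^sup>2) = M"
      using M ab(2) by simp
    show "(\<Prod>y\<leftarrow>ys. 1 + y\<^sup>2) = m\<^sup>2"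
      unfolding m[symmetric] by (simp add: ys_def ab) algebra
    show "0 \<le> \<mu>"
      using assms(2,4) by (simp add: \<mu>_def field_simps)
  qed (use assms pq in \<open>auto simp: ys_def\<close>)
  then show ?thesis
    unfolding poly proots_prod_linear_factors .
qed

text \<open>The extra root \<open>0\<close> adds \<open>1 / y\<close> to the equation at
  \<open>y\<close>, hence \<open>\<kappa> = 3\<close>, and it multiplies the discriminant by
  \<open>b\<^sup>2\<close>. Nonnegativity of \<open>\<mu>\<close> becomes
  \<open>2 * b \<le> a\<close>.\<close>

lemma discriminant_maximal_odd_quintic:
  fixes a b m :: real
  assumes "0 < a" "0 < b" and stationary: "3 * (a\<^sup>2 - 4 * b) = 4 * b * (2 + a)"
    and "2 * b \<le> a" and m: "1 + a + b = m"
    and M: "16 * b ^ 3 * (a\<^sup>2 - 4 * b)\<^sup>2 = M"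
  shows "is_max_value discriminant (real_rooted_monic 5 m) M \<and>
    (\<forall>f\<in>real_rooted_monic 5 m. discriminant f = M \<longleftrightarrow> proots f = proots [:0, b, 0, - a, 0, 1:])"
proof -
  have "0 < 4 * b * (2 + a)"
    using assms(1,2) by simp
  then have "4 * b < a\<^sup>2"
    using stationary by simp
  then obtain p q where pq: "0 < q" "q < p" and ab: "a = p\<^sup>2 + q\<^sup>2" "b = p\<^sup>2 * q\<^sup>2"
    using biquadratic_roots assms(1,2) by metis
  define ys where "ys = [- p, - q, 0, q, p]"
  have poly: "[:0, b, 0, - a, 0, 1:] = (\<Prod>y\<leftarrow>ys. [:- y, 1:])"
    by (simp add: ys_def ab algebra_simps power2_eq_square)
  have sq: "p\<^sup>2 \<noteq> q\<^sup>2"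
    using pq by (simp add: power2_eq_iff)
  define \<mu> where "\<mu> = 3 * a / (4 * b) - 3 / 2"
  have critical_p: "(3 - p\<^sup>2) / (2 * p) + (1 + p * q) / (p - q) + (1 - p * q) / (p + q) = \<mu> * p"
    using critical_pairs[of p q 3] pq sq stationary
    by (simp add: \<mu>_def ab algebra_simps power2_eq_square)
  have critical_q: "(3 - q\<^sup>2) / (2 * q) + (1 + q * p) / (q - p) + (1 - q * p) / (q + p) = \<mu> * q"
    using critical_pairs[of q p 3] pq sq stationary
    by (simp add: \<mu>_def ab algebra_simps power2_eq_square)
  have self: "(3 - y\<^sup>2) / (2 * y) = (1 - y\<^sup>2) / (2 * y) + 1 / y" if "y \<noteq> 0" for y :: real
    using that by (simp add: field_simps)
  have "is_max_value discriminant (real_rooted_monic 5 m) M \<and>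
    (\<forall>f\<in>real_rooted_monic 5 m. discriminant f = M \<longleftrightarrow> proots f = mset ys)"
  proof (rule discriminant_maximal[where \<mu> = \<mu>])
    have odd: "(\<Sum>z\<leftarrow>ys. (1 + - y * z) / (- y - z)) = - (\<Sum>z\<leftarrow>ys. (1 + y * z) / (y - z))" for y
      unfolding one_plus_mult_over_diff_uminus by (simp add: ys_def)
    have "(\<Sum>z\<leftarrow>ys. (1 + p * z) / (p - z)) = \<mu> * p"
      using critical_p self[of p] pq by (simp add: ys_def power2_eq_square algebra_simps)
    moreover have "(\<Sum>z\<leftarrow>ys. (1 + q * z) / (q - z)) = \<mu> * q"
      using critical_q self[of q] pq by (simp add: ys_def power2_eq_square algebra_simps)
    moreover have "(\<Sum>z\<leftarrow>ys. (1 + 0 * z) / (0 - z)) = 0"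
      by (simp add: ys_def)
    ultimately show "(\<Sum>z\<leftarrow>ys. (1 + y * z) / (y - z)) = \<mu> * y" if "y \<in> set ys" for y
      using that odd[of p] odd[of q] unfolding ys_def by auto
    have "(\<Prod>k<5. \<Prod>j<k. (ys ! j - ys ! k)\<^sup>2) = 16 * (p\<^sup>2 * q\<^sup>2) ^ 3 * ((p - q)\<^sup>2 * (p + q)\<^sup>2)\<^sup>2"
      by (simp add: ys_def eval_nat_numeral lessThan_Suc) algebra
    also have "(p - q)\<^sup>2 * (p + q)\<^sup>2 = a\<^sup>2 - 4 * b"
      unfolding ab by algebra
    finally show "(\<Prod>k<5. \<Prod>j<k. (ys ! j - ys ! k)\<^sup>2) = M"
      using M ab(2) by simp
    show "(\<Prod>y\<leftarrow>ys. 1 + y\<^sup>2) = m\<^sup>2"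
      unfolding m[symmetric] by (simp add: ys_def ab) algebra
    show "0 \<le> \<mu>"
      using assms(2,4) by (simp add: \<mu>_def field_simps)
  qed (use assms pq in \<open>auto simp: ys_def\<close>)
  then show ?thesis
    unfolding poly proots_prod_linear_factors .
qed

section \<open>Explicit coefficients as functions of \<open>m\<close>\<close>

lemma powr_three_halves:
  fixes x :: real
  assumes "0 < x"
  shows "x powr (3 / 2) = sqrt x ^ 3"
  using assms by (simp add: powr_half_sqrt[symmetric] powr_powr flip: powr_realpow)

text \<open>Substituting \<open>b = m - 1 - a\<close> into the stationarity equation gives
  \<open>5 * a\<^sup>2 - 4 * (m - 4) * a - 12 * (m - 1) = 0\<close>, and \<open>a\<close> is its
  positive root.\<close>

lemma quartic_parameters:
  fixes m :: real
  assumes "1 < m" "m \<le> 8"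
  defines "s \<equiv> sqrt (m\<^sup>2 + 7 * m + 1)"
  defines "a \<equiv> 2 / 5 * (m - 4 + s)" and "b \<equiv> (3 * m + 3 - 2 * s) / 5"
  shows "0 < a" "0 < b" "a\<^sup>2 - 4 * b = 4 * b * (2 + a)" "6 * b \<le> a" "1 + a + b = m"
    and "16 * b * (a\<^sup>2 - 4 * b)\<^sup>2 = 1024 / 3125 *
      (2 * (m\<^sup>2 + 7 * m + 1) powr (3 / 2) * (m\<^sup>2 - 18 * m + 1)
        + (m + 1) * (2 * m ^ 4 - 17 * m ^ 3 + 462 * m\<^sup>2 - 17 * m + 2))"
proof -
  have pos: "0 < m\<^sup>2 + 7 * m + 1"
    using assms(1) by (simp add: add_pos_nonneg add_nonneg_pos)
  then have s: "0 < s" "s\<^sup>2 = m\<^sup>2 + 7 * m + 1"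
    by (simp_all add: s_def)
  have "9 < m\<^sup>2 + 7 * m + 1"
    using assms(1) one_less_power[OF assms(1) pos2] by linarith
  then have "3 < s"
    unfolding s_def by (intro real_less_rsqrt) simp
  then show "0 < a"
    using assms(1) by (simp add: a_def)
  have "0 < 5 * (m - 1)\<^sup>2"
    using assms(1) by simp
  also have "\<dots> = (3 * (m + 1))\<^sup>2 - (2 * s)\<^sup>2"
    by (simp add: power_mult_distrib s(2)) (simp add: power2_eq_square algebra_simps)
  finally have "2 * s < 3 * (m + 1)"
    using assms(1) by (intro power2_less_imp_less[of "2 * s"]) simp_all
  then show "0 < b"
    by (simp add: b_def)
  show "a\<^sup>2 - 4 * b = 4 * b * (2 + a)"
    unfolding a_def b_def using s(2) by (simp add: field_simps) algebra
  \<comment> \<open>\<open>6 * b \<le> a\<close> amounts to \<open>8 * m + 13 \<le> 7 * s\<close>;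
    comparing squares shows where \<open>m \<le> 8\<close> comes from.\<close>
  have "0 \<le> 15 * ((m - 1) * (8 - m))"
    using assms by simp
  also have "\<dots> = (7 * s)\<^sup>2 - (8 * m + 13)\<^sup>2"
    by (simp add: power_mult_distrib s(2)) (simp add: power2_eq_square algebra_simps)
  finally have "8 * m + 13 \<le> 7 * s"
    using s(1) by (intro power2_le_imp_le[of "8 * m + 13"]) simp_all
  then show "6 * b \<le> a"
    by (simp add: a_def b_def)
  show "1 + a + b = m"
    by (simp add: a_def b_def field_simps)
  show "16 * b * (a\<^sup>2 - 4 * b)\<^sup>2 = 1024 / 3125 *
      (2 * (m\<^sup>2 + 7 * m + 1) powr (3 / 2) * (m\<^sup>2 - 18 * m + 1)
        + (m + 1) * (2 * m ^ 4 - 17 * m ^ 3 + 462 * m\<^sup>2 - 17 * m + 2))"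
    \<comment> \<open>With the power written as \<open>s ^ 3\<close>, a polynomial identity modulo
      the equation for \<open>s\<^sup>2\<close> remains.\<close>
    unfolding powr_three_halves[OF pos] s_def[symmetric] a_def b_def
    using s(2) by (simp add: field_simps) algebra
qed

text \<open>Here the elimination of \<open>b\<close> yields
  \<open>7 * a\<^sup>2 - 4 * (m - 6) * a - 20 * (m - 1) = 0\<close>, again solved by its positive
  root.\<close>

lemma quintic_parameters:
  fixes m :: real
  assumes "1 < m" "m \<le> 16"
  defines "s \<equiv> sqrt (m\<^sup>2 + 23 * m + 1)"
  defines "a \<equiv> 2 / 7 * (m - 6 + s)" and "b \<equiv> (5 * m + 5 - 2 * s) / 7"
  shows "0 < a" "0 < b" "3 * (a\<^sup>2 - 4 * b) = 4 * b * (2 + a)" "2 * b \<le> a" "1 + a + b = m"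
    and "16 * b ^ 3 * (a\<^sup>2 - 4 * b)\<^sup>2 = 55296 / 823543 * (m\<^sup>2 + 23 * m + 1) powr (3 / 2)
        * (m\<^sup>2 - 54 * m - 27) * (m\<^sup>2 + 2 * m - 1 / 27)
      + 55296 / 823543 * (m + 1) *
        (m ^ 6 - 37 / 2 * m ^ 5 + 56755 / 27 * m ^ 4 + 287435 / 27 * m ^ 3
         + 56755 / 27 * m\<^sup>2 - 37 / 2 * m + 1)"
proof -
  have pos: "0 < m\<^sup>2 + 23 * m + 1"
    using assms(1) by (simp add: add_pos_nonneg add_nonneg_pos)
  then have s: "0 < s" "s\<^sup>2 = m\<^sup>2 + 23 * m + 1"
    by (simp_all add: s_def)
  have "25 < m\<^sup>2 + 23 * m + 1"
    using assms(1) one_less_power[OF assms(1) pos2] by linarith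
  then have "5 < s"
    unfolding s_def by (intro real_less_rsqrt) simp
  then show "0 < a"
    using assms(1) by (simp add: a_def)
  have "0 < 21 * (m - 1)\<^sup>2"
    using assms(1) by simp
  also have "\<dots> = (5 * (m + 1))\<^sup>2 - (2 * s)\<^sup>2"
    by (simp add: power_mult_distrib s(2)) (simp add: power2_eq_square algebra_simps)
  finally have "2 * s < 5 * (m + 1)"
    using assms(1) by (intro power2_less_imp_less[of "2 * s"]) simp_all
  then show "0 < b"
    by (simp add: b_def)
  show "3 * (a\<^sup>2 - 4 * b) = 4 * b * (2 + a)"
    unfolding a_def b_def using s(2) by (simp add: field_simps) algebra
  \<comment> \<open>\<open>2 * b \<le> a\<close> amounts to \<open>4 * m + 11 \<le> 3 * s\<close>,
    which is where \<open>m \<le> 16\<close> enters.\<close>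
  have "0 \<le> 7 * ((m - 1) * (16 - m))"
    using assms by simp
  also have "\<dots> = (3 * s)\<^sup>2 - (4 * m + 11)\<^sup>2"
    by (simp add: power_mult_distrib s(2)) (simp add: power2_eq_square algebra_simps)
  finally have "4 * m + 11 \<le> 3 * s"
    using s(1) by (intro power2_le_imp_le[of "4 * m + 11"]) simp_all
  then show "2 * b \<le> a"
    by (simp add: a_def b_def)
  show "1 + a + b = m"
    by (simp add: a_def b_def field_simps)
  show "16 * b ^ 3 * (a\<^sup>2 - 4 * b)\<^sup>2 = 55296 / 823543 * (m\<^sup>2 + 23 * m + 1) powr (3 / 2)
        * (m\<^sup>2 - 54 * m - 27) * (m\<^sup>2 + 2 * m - 1 / 27)
      + 55296 / 823543 * (m + 1) *
        (m ^ 6 - 37 / 2 * m ^ 5 + 56755 / 27 * m ^ 4 + 287435 / 27 * m ^ 3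
         + 56755 / 27 * m\<^sup>2 - 37 / 2 * m + 1)"
    unfolding powr_three_halves[OF pos] s_def[symmetric] a_def b_def
    using s(2) by (simp add: field_simps) algebra
qed

theorem corollary6:
  fixes m :: real
  shows
    "(1 < m \<and> m \<le> 2 \<longrightarrow>
       is_max_value discriminant (real_rooted_monic 2 m) (4 * (m - 1)) \<and>
       (\<forall>f\<in>real_rooted_monic 2 m. discriminant f = 4 * (m - 1) \<longleftrightarrow>
          proots f = {#- sqrt (m - 1), sqrt (m - 1)#})) \<and>
     (1 < m \<and> m \<le> 4 \<longrightarrow>
       is_max_value discriminant (real_rooted_monic 3 m) (4 * (m - 1) ^ 3) \<and>
       (\<forall>f\<in>real_rooted_monic 3 m. discriminant f = 4 * (m - 1) ^ 3 \<longleftrightarrow>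
          proots f = {#- sqrt (m - 1), 0, sqrt (m - 1)#})) \<and>
     (1 < m \<and> m \<le> 8 \<longrightarrow>
       (let M = 1024 / 3125 *
              (2 * (m\<^sup>2 + 7 * m + 1) powr (3 / 2) * (m\<^sup>2 - 18 * m + 1)
               + (m + 1) * (2 * m ^ 4 - 17 * m ^ 3 + 462 * m\<^sup>2 - 17 * m + 2));
            G = [: (3 * m + 3 - 2 * sqrt (m\<^sup>2 + 7 * m + 1)) / 5, 0,
                   - (2 / 5 * (m - 4 + sqrt (m\<^sup>2 + 7 * m + 1))), 0, 1 :]
        in is_max_value discriminant (real_rooted_monic 4 m) M \<and>
           (\<forall>f\<in>real_rooted_monic 4 m. discriminant f = M \<longleftrightarrow> proots f = proots G))) \<and>
     (1 < m \<and> m \<le> 16 \<longrightarrow>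
       (let M = 55296 / 823543 * (m\<^sup>2 + 23 * m + 1) powr (3 / 2)
                * (m\<^sup>2 - 54 * m - 27) * (m\<^sup>2 + 2 * m - 1 / 27)
              + 55296 / 823543 * (m + 1) *
                (m ^ 6 - 37 / 2 * m ^ 5 + 56755 / 27 * m ^ 4 + 287435 / 27 * m ^ 3
                 + 56755 / 27 * m\<^sup>2 - 37 / 2 * m + 1);
            G = [: 0, (5 * m + 5 - 2 * sqrt (m\<^sup>2 + 23 * m + 1)) / 7, 0,
                   - (2 / 7 * (m - 6 + sqrt (m\<^sup>2 + 23 * m + 1))), 0, 1 :]
        in is_max_value discriminant (real_rooted_monic 5 m) M \<and>
           (\<forall>f\<in>real_rooted_monic 5 m. discriminant f = M \<longleftrightarrow> proots f = proots G)))"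
  unfolding Let_def
\<comment> \<open>The instance of \<open>conjI\<close> splits only in front of implications, so the
  maximum and its equality case stay together in each degree.\<close>
proof (intro conjI[of "_ \<longrightarrow> _"] impI; elim conjE)
  assume "1 < m" "m \<le> 2"
  then show "is_max_value discriminant (real_rooted_monic 2 m) (4 * (m - 1)) \<and>
       (\<forall>f\<in>real_rooted_monic 2 m. discriminant f = 4 * (m - 1) \<longleftrightarrow>
          proots f = {#- sqrt (m - 1), sqrt (m - 1)#})"
    by (rule discriminant_maximal_quadratic)
next
  assume "1 < m" "m \<le> 4"
  then show "is_max_value discriminant (real_rooted_monic 3 m) (4 * (m - 1) ^ 3) \<and>
       (\<forall>f\<in>real_rooted_monic 3 m. discriminant f = 4 * (m - 1) ^ 3 \<longleftrightarrow>
          proots f = {#- sqrt (m - 1), 0, sqrt (m - 1)#})"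
    by (rule discriminant_maximal_cubic)
qed (rule discriminant_maximal_biquadratic[OF quartic_parameters]
    discriminant_maximal_odd_quintic[OF quintic_parameters]; assumption)+

end
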